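(* Let $m\ge 2$, $n\ge 1$. For each $\vec{b}=(b_1,b_2,\dots,b_n)\in(B_m)^n$, the characteristic polynomial of $\vec{b}$ factors as $P(\vec{b})=(x-a_1)(x-a_2)\cdots(x-a_{mn})$, where $a_1,a_2,\dots,a_{mn}\in\mathbb{R}$ and $a_1+a_2+\dots+a_{mn}=0$.
   Context: $B_m$ ($m\ge 2$) is the $m$-strand braid group with standard generators $\sigma_1,\dots,\sigma_{m-1}$ and relations $\sigma_i\sigma_j\sigma_i=\sigma_j\sigma_i\sigma_j$ for $|i-j|=1$, $\sigma_i\sigma_j=\sigma_j\sigma_i$ for $|i-j|>1$. Braids are read from top to bottom, $bc$ meaning $b$ placed above $c$. The $k$-th strand of a braid (diagram) is the strand whose upper endpoint is at the $k$-th position from the left. The letter $\sigma_i$ is a positive crossing between the strands currently at positions $i$ and $i+1$, at which the strand at position $i$ passes over; $\sigma_i^{-1}$ is a negative crossing between the strands currently at positions $i$ and $i+1$, at which the strand at position $i+1$ passes over. The crossing matrix $C(b)$ of $b\in B_m$ is the $m\times m$ integer matrix with zero diagonal whose $(i,j)$-entry ($i\neq j$) is, for any diagram (word) of $b$, the number of positive crossings minus the number of negative crossings between the $i$-th and $j$-th strands at which the $i$-th strand passes over the $j$-th strand; it does not depend on the diagram. The braid permutation of $b$ is the permutation of $\{1,\dots,m\}$ sending $k$ to the bottom position of the $k$-th strand. If $r$ is the order of the braid permutation of $b$, the characteristic polynomial of $b$ is $P(b)=\det(xI-C(b^r))$, with $I$ the $m\times m$ identity matrix. For $\vec{b}=(b_1,\dots,b_n)\in(B_m)^n$,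 $P(\vec{b})=P(b_1)P(b_2)\cdots P(b_n)$. *)

theory Defs
  imports
    Jordan_Normal_Form.Char_Poly
    "HOL-Algebra.Multiplicative_Group"
    "HOL-Algebra.Sym_Groups"
begin

subsection \<open>The braid group, presented by generators and relations\<close>

text \<open>\<open>Gen i\<close> is the letter $\sigma_i$ and \<open>GenInv i\<close> the letter $\sigma_i^{-1}$.\<close>

datatype braid_letter = Gen (gen_index: nat) | GenInv (gen_index: nat)

definition braid_words :: "nat \<Rightarrow> braid_letter list set" where
  "braid_words m = {w. \<forall>c\<in>set w. gen_index c \<in> {1..<m}}"

inductive braid_equiv :: "nat \<Rightarrow> braid_letter list \<Rightarrow> braid_letter list \<Rightarrow> bool"
  for m :: nat where
  refl: "w \<in> braid_words m \<Longrightarrow> braid_equiv m w w"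
| sym: "braid_equiv m u v \<Longrightarrow> braid_equiv m v u"
| trans: "braid_equiv m u v \<Longrightarrow> braid_equiv m v w \<Longrightarrow> braid_equiv m u w"
| append: "braid_equiv m u u' \<Longrightarrow> braid_equiv m v v' \<Longrightarrow> braid_equiv m (u @ v) (u' @ v')"
| cancel_right: "i \<in> {1..<m} \<Longrightarrow> braid_equiv m [Gen i, GenInv i] []"
| cancel_left: "i \<in> {1..<m} \<Longrightarrow> braid_equiv m [GenInv i, Gen i] []"
| braid: "i \<in> {1..<m} \<Longrightarrow> Suc i \<in> {1..<m} \<Longrightarrow>
    braid_equiv m [Gen i, Gen (Suc i), Gen i] [Gen (Suc i), Gen i, Gen (Suc i)]"
| far_commute: "i \<in> {1..<m} \<Longrightarrow> j \<in> {1..<m} \<Longrightarrow> Suc i < j \<Longrightarrow>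
    braid_equiv m [Gen i, Gen j] [Gen j, Gen i]"

definition braid_rel :: "nat \<Rightarrow> (braid_letter list \<times> braid_letter list) set" where
  "braid_rel m = {(u, v). braid_equiv m u v}"

definition braid_group :: "nat \<Rightarrow> braid_letter list set monoid" where
  "braid_group m =
     \<lparr>carrier = braid_words m // braid_rel m,
      mult = (\<lambda>A B. \<Union>u\<in>A. \<Union>v\<in>B. braid_rel m `` {u @ v}),
      one = braid_rel m `` {[]}\<rparr>"

lemma braid_words_Nil [simp]: "[] \<in> braid_words m"
  by (simp add: braid_words_def)

lemma braid_words_append [simp]:
  "u @ v \<in> braid_words m \<longleftrightarrow> u \<in> braid_words m \<and> v \<in> braid_words m"
  by (auto simp: braid_words_def)

lemma braid_equiv_words:
  "braid_equiv m u v \<Longrightarrow> u \<in> braid_words m \<and> v \<in> braid_words m"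
  by (induction rule: braid_equiv.induct) (auto simp: braid_words_def)

lemma equiv_braid_rel: "equiv (braid_words m) (braid_rel m)"
  by (rule equivI)
     (auto simp: refl_on_def sym_on_def trans_on_def braid_rel_def
        dest: braid_equiv_words intro: braid_equiv.intros)

lemma braid_mult_class:
  assumes "u \<in> braid_words m" "v \<in> braid_words m"
  shows "(braid_rel m `` {u}) \<otimes>\<^bsub>braid_group m\<^esub> (braid_rel m `` {v}) = braid_rel m `` {u @ v}"
proof -
  have "(\<lambda>u v. braid_rel m `` {u @ v}) respects2 braid_rel m"
    by (rule congruent2I', rule equiv_class_eq[OF equiv_braid_rel])
       (simp add: braid_rel_def braid_equiv.append)
  from UN_equiv_class2[OF equiv_braid_rel equiv_braid_rel this assms]
  show ?thesis by (simp add: braid_group_def)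
qed

fun inv_letter :: "braid_letter \<Rightarrow> braid_letter" where
  "inv_letter (Gen i) = GenInv i"
| "inv_letter (GenInv i) = Gen i"

lemma gen_index_inv_letter [simp]: "gen_index (inv_letter c) = gen_index c"
  by (cases c) auto

lemma inv_word_in: "w \<in> braid_words m \<Longrightarrow> rev (map inv_letter w) \<in> braid_words m"
  by (auto simp: braid_words_def)

lemma inv_word_equiv:
  "w \<in> braid_words m \<Longrightarrow> braid_equiv m (rev (map inv_letter w) @ w) []"
proof (induction w)
  case Nil
  then show ?case by (simp add: braid_equiv.refl)
next
  case (Cons c w)
  have w: "w \<in> braid_words m" and c: "gen_index c \<in> {1..<m}"
    using Cons.prems by (auto simp: braid_words_def)
  have cc: "braid_equiv m [inv_letter c, c] []"
    using c by (cases c) (auto intro: braid_equiv.cancel_left braid_equiv.cancel_right)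
  have "braid_equiv m (rev (map inv_letter w) @ [inv_letter c, c] @ w)
          (rev (map inv_letter w) @ [] @ w)"
    by (intro braid_equiv.append cc braid_equiv.refl w inv_word_in)
  then show ?case using braid_equiv.trans Cons.IH[OF w] by simp
qed

lemma group_braid_group: "group (braid_group m)"
proof (rule groupI)
  have car: "carrier (braid_group m) = braid_words m // braid_rel m"
    by (simp add: braid_group_def)
  have one: "\<one>\<^bsub>braid_group m\<^esub> = braid_rel m `` {[]}"
    by (simp add: braid_group_def)
  show "x \<otimes>\<^bsub>braid_group m\<^esub> y \<in> carrier (braid_group m)"
    if "x \<in> carrier (braid_group m)" "y \<in> carrier (braid_group m)" for x y
    using that unfolding car by (auto elim!: quotientE simp: braid_mult_class intro!: quotientI)
  show "\<one>\<^bsub>braid_group m\<^esub> \<in> carrier (braid_group m)"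
    unfolding car one by (auto intro!: quotientI)
  show "x \<otimes>\<^bsub>braid_group m\<^esub> y \<otimes>\<^bsub>braid_group m\<^esub> z =
        x \<otimes>\<^bsub>braid_group m\<^esub> (y \<otimes>\<^bsub>braid_group m\<^esub> z)"
    if "x \<in> carrier (braid_group m)" "y \<in> carrier (braid_group m)"
       "z \<in> carrier (braid_group m)" for x y z
    using that unfolding car by (auto elim!: quotientE simp: braid_mult_class)
  show "\<one>\<^bsub>braid_group m\<^esub> \<otimes>\<^bsub>braid_group m\<^esub> x = x"
    if "x \<in> carrier (braid_group m)" for x
    using that unfolding car one by (auto elim!: quotientE simp: braid_mult_class)
  show "\<exists>y\<in>carrier (braid_group m). y \<otimes>\<^bsub>braid_group m\<^esub> x = \<one>\<^bsub>braid_group m\<^esub>"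
    if x: "x \<in> carrier (braid_group m)" for x
  proof -
    from x obtain w where w: "w \<in> braid_words m" "x = braid_rel m `` {w}"
      unfolding car by (auto elim!: quotientE)
    have "(rev (map inv_letter w) @ w, []) \<in> braid_rel m"
      using inv_word_equiv[OF w(1)] by (simp add: braid_rel_def)
    then have "(braid_rel m `` {rev (map inv_letter w)}) \<otimes>\<^bsub>braid_group m\<^esub> x = \<one>\<^bsub>braid_group m\<^esub>"
      using equiv_class_eq[OF equiv_braid_rel]
      by (simp add: w braid_mult_class inv_word_in one)
    moreover have "braid_rel m `` {rev (map inv_letter w)} \<in> carrier (braid_group m)"
      unfolding car by (intro quotientI inv_word_in w)
    ultimately show ?thesis by blast
  qed
qed

subsection \<open>Strands and crossings\<close>

fun over_pos :: "braid_letter \<Rightarrow> nat" where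
  "over_pos (Gen i) = i"
| "over_pos (GenInv i) = Suc i"

fun under_pos :: "braid_letter \<Rightarrow> nat" where
  "under_pos (Gen i) = Suc i"
| "under_pos (GenInv i) = i"

fun crossing_sign :: "braid_letter \<Rightarrow> int" where
  "crossing_sign (Gen i) = 1"
| "crossing_sign (GenInv i) = - 1"

definition letter_swap :: "braid_letter \<Rightarrow> nat \<Rightarrow> nat" where
  "letter_swap c = Transposition.transpose (gen_index c) (Suc (gen_index c))"

text \<open>The head of a word is the topmost letter; \<open>strand_end w k\<close> is the bottom position
  of the \<open>k\<close>-th strand.\<close>

fun strand_end :: "braid_letter list \<Rightarrow> nat \<Rightarrow> nat" where
  "strand_end [] k = k"
| "strand_end (c # w) k = strand_end w (letter_swap c k)"

text \<open>Signed number of crossings of \<open>w\<close> at which strand \<open>i\<close> passes over strand \<open>j\<close>: in the recursion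
  the two strands are followed through their current positions.\<close>

fun signed_over :: "braid_letter list \<Rightarrow> nat \<Rightarrow> nat \<Rightarrow> int" where
  "signed_over [] i j = 0"
| "signed_over (c # w) i j =
     (if i = over_pos c \<and> j = under_pos c then crossing_sign c else 0) +
     signed_over w (letter_swap c i) (letter_swap c j)"

text \<open>Strands are numbered from 1, matrix indices start at 0.\<close>

definition word_crossing_matrix :: "nat \<Rightarrow> braid_letter list \<Rightarrow> int mat" where
  "word_crossing_matrix m w =
     mat m m (\<lambda>(i, j). if i = j then 0 else signed_over w (Suc i) (Suc j))"

text \<open>Both notions below are independent of the chosen representative: see
  \<open>braid_perm_class\<close> and \<open>crossing_matrix_class\<close>.\<close>

definition braid_perm :: "braid_letter list set \<Rightarrow> nat \<Rightarrow> nat" where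
  "braid_perm b = strand_end (SOME w. w \<in> b)"

definition crossing_matrix :: "nat \<Rightarrow> braid_letter list set \<Rightarrow> int mat" where
  "crossing_matrix m b = word_crossing_matrix m (SOME w. w \<in> b)"

definition braid_perm_order :: "nat \<Rightarrow> braid_letter list set \<Rightarrow> nat" where
  "braid_perm_order m b = group.ord (sym_group m) (braid_perm b)"

definition braid_char_poly :: "nat \<Rightarrow> braid_letter list set \<Rightarrow> int poly" where
  "braid_char_poly m b =
     char_poly (crossing_matrix m (b [^]\<^bsub>braid_group m\<^esub> braid_perm_order m b))"

definition braid_tuple_char_poly :: "nat \<Rightarrow> braid_letter list set list \<Rightarrow> int poly" where
  "braid_tuple_char_poly m bs = prod_list (map (braid_char_poly m) bs)"

subsection \<open>Independence of the representing word\<close>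

lemma strand_end_append: "strand_end (u @ v) k = strand_end v (strand_end u k)"
  by (induction u arbitrary: k) auto

lemma signed_over_append:
  "signed_over (u @ v) i j = signed_over u i j + signed_over v (strand_end u i) (strand_end u j)"
  by (induction u arbitrary: i j) auto

lemma strand_end_equiv: "braid_equiv m u v \<Longrightarrow> strand_end u k = strand_end v k"
  by (induction arbitrary: k rule: braid_equiv.induct)
     (auto simp: strand_end_append letter_swap_def Transposition.transpose_def)

lemma signed_over_equiv: "braid_equiv m u v \<Longrightarrow> signed_over u i j = signed_over v i j"
proof (induction arbitrary: i j rule: braid_equiv.induct)
  case (append u u' v v')
  then show ?case by (simp add: signed_over_append strand_end_equiv)
qed (auto simp: letter_swap_def Transposition.transpose_def)

lemma some_in_class:
  assumes "w \<in> braid_words m"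
  shows "braid_equiv m w (SOME u. u \<in> braid_rel m `` {w})"
proof -
  have "w \<in> braid_rel m `` {w}"
    using assms equiv_class_self[OF equiv_braid_rel] by blast
  then have "(SOME u. u \<in> braid_rel m `` {w}) \<in> braid_rel m `` {w}"
    by (rule someI)
  then show ?thesis by (simp add: braid_rel_def)
qed

lemma braid_perm_class:
  "w \<in> braid_words m \<Longrightarrow> braid_perm (braid_rel m `` {w}) = strand_end w"
  unfolding braid_perm_def using strand_end_equiv[OF some_in_class] by (metis ext)

lemma crossing_matrix_class:
  "w \<in> braid_words m \<Longrightarrow> crossing_matrix m (braid_rel m `` {w}) = word_crossing_matrix m w"
  unfolding crossing_matrix_def word_crossing_matrix_def
  using signed_over_equiv[OF some_in_class] by (intro cong_mat) auto

lemma strand_end_permutes: "w \<in> braid_words m \<Longrightarrow> strand_end w permutes {1..m}"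
proof (induction w)
  case Nil
  then show ?case by (simp add: permutes_def)
next
  case (Cons c w)
  then have "letter_swap c permutes {1..m}"
    unfolding letter_swap_def by (intro permutes_swap_id) (auto simp: braid_words_def)
  moreover have "strand_end w permutes {1..m}"
    using Cons by (auto simp: braid_words_def)
  moreover have "strand_end (c # w) = strand_end w \<circ> letter_swap c"
    by auto
  ultimately show ?case by (metis permutes_compose)
qed

end

theory Submission
  imports Defs "Jordan_Normal_Form.Schur_Decomposition"
begin

text \<open>Every factor $P(b)$ is the characteristic polynomial of a symmetric integer matrix with
  zero diagonal; such a matrix has only real eigenvalues, and they add up to its trace, which is 0.

  Symmetry comes from following the relative order of two strands. They exchange their left-right
  order exactly at their mutual crossings, and the letters are signed so that each such crossing
  contributes to $C_{ij} - C_{ji}$ the truth value (0 or 1) of ``strand \<open>i\<close> is to the left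
  of strand \<open>j\<close>'' just above the crossing minus its value just below. The contributions telescope, so $C_{ij} - C_{ji}$ depends only
  on the order of the two strands at the top and at the bottom (\<open>signed_over_skew\<close>). The
  power $b^r$ is a pure braid, because its permutation is the $r$-th power of that of $b$ and
  $r$ is the order of the latter. Hence both orders agree and the matrix is symmetric
  (\<open>crossing_matrix_power_order_symmetric\<close>).

  The linear algebra consists of the reality of Hermitian eigenvalues, which lets the complex
  factorization of the characteristic polynomial descend to the reals
  (\<open>real_symmetric_char_poly_splits\<close>), and of the trace formula
  \<open>sum_list_eigenvalues_eq_sum_diagonal\<close>. Concatenating the lists of roots of the factors
  then gives the statement for a tuple.\<close>

section \<open>Crossings of pure braids\<close>

lemma letter_swap_eq_iff: "letter_swap c i = letter_swap c j \<longleftrightarrow> i = j"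
  by (auto simp: letter_swap_def Transposition.transpose_def split: if_splits)

text \<open>If the letter \<open>c\<close> does not make the strands at \<open>i\<close> and \<open>j\<close> cross,
  their order is unchanged and both sides vanish. Otherwise both sides are 1 if \<open>i\<close> is the
  left one of the two and -1 if it is the right one: an inverse letter has the opposite sign, but
  there it is the right strand that passes over.\<close>

lemma letter_crossing_skew:
  assumes "i \<noteq> j"
  shows "signed_over [c] i j - signed_over [c] j i =
    of_bool (i < j) - of_bool (letter_swap c i < letter_swap c j)"
  using assms by (cases c) (auto simp: letter_swap_def Transposition.transpose_def)

text \<open>The differences given by \<open>letter_crossing_skew\<close> telescope along the word: what remains
  is the order at the top minus the order at the bottom.\<close>

lemma signed_over_skew:
  assumes "i \<noteq> j"
  shows "signed_over w i j - signed_over w j i =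
    of_bool (i < j) - of_bool (strand_end w i < strand_end w j)"
  using assms
proof (induction w arbitrary: i j)
  case (Cons c w)
  then have "letter_swap c i \<noteq> letter_swap c j"
    by (simp add: letter_swap_eq_iff)
  from Cons.IH[OF this] letter_crossing_skew[OF Cons.prems, of c]
  show ?case by simp
qed simp

lemma word_crossing_matrix_pure_symmetric:
  assumes "strand_end w = id"
  shows "transpose_mat (word_crossing_matrix m w) = word_crossing_matrix m w"
  using signed_over_skew[of "Suc i" "Suc j" w for i j]
  by (intro eq_matI) (auto simp: word_crossing_matrix_def assms)

lemma strand_end_power: "strand_end (concat (replicate k w)) = strand_end w ^^ k"
  by (induction k) (auto simp: strand_end_append fun_eq_iff funpow_swap1)

lemma braid_words_power: "w \<in> braid_words m \<Longrightarrow> concat (replicate k w) \<in> braid_words m"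
  by (auto simp: braid_words_def)

lemma braid_class_power:
  assumes "w \<in> braid_words m"
  shows "(braid_rel m `` {w}) [^]\<^bsub>braid_group m\<^esub> k = braid_rel m `` {concat (replicate k w)}"
proof (induction k)
  case 0
  then show ?case by (simp add: braid_group_def)
next
  case (Suc k)
  have "concat (replicate k w) @ w = concat (replicate (Suc k) w)"
    by (induction k) auto
  then show ?case
    using Suc assms
    by (simp add: braid_mult_class braid_words_power del: append_assoc concat.simps replicate.simps)
qed

text \<open>Turns the order of the braid permutation, which is an order in the symmetric group, into a
  statement about iterating the function \<open>strand_end w\<close>.\<close>

lemma sym_group_power: "p [^]\<^bsub>sym_group m\<^esub> (k :: nat) = p ^^ k"
  by (induction k) (simp_all add: sym_group_one sym_group_mult funpow_Suc_right del: funpow.simps(2))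

lemma crossing_matrix_carrier: "crossing_matrix m b \<in> carrier_mat m m"
  by (simp add: crossing_matrix_def word_crossing_matrix_def)

lemma crossing_matrix_diagonal: "i < m \<Longrightarrow> crossing_matrix m b $$ (i, i) = 0"
  by (simp add: crossing_matrix_def word_crossing_matrix_def)

text \<open>The exponent is chosen so that the power is a pure braid, and for pure braids the order of two
  strands at the bottom is that at the top.\<close>

lemma crossing_matrix_power_order_symmetric:
  assumes "b \<in> carrier (braid_group m)"
  shows "transpose_mat (crossing_matrix m (b [^]\<^bsub>braid_group m\<^esub> braid_perm_order m b)) =
    crossing_matrix m (b [^]\<^bsub>braid_group m\<^esub> braid_perm_order m b)"
proof -
  obtain w where w: "w \<in> braid_words m" "b = braid_rel m `` {w}"
    using assms by (auto simp: braid_group_def elim: quotientE)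
  define r where "r = braid_perm_order m b"
  have "strand_end w \<in> carrier (sym_group m)"
    using strand_end_permutes[OF w(1)] by (simp add: sym_group_carrier)
  then have "strand_end w [^]\<^bsub>sym_group m\<^esub> r = \<one>\<^bsub>sym_group m\<^esub>"
    unfolding r_def braid_perm_order_def w(2) braid_perm_class[OF w(1)]
    by (rule group.pow_ord_eq_1[OF sym_group_is_group])
  then have "strand_end (concat (replicate r w)) = id"
    by (simp add: strand_end_power sym_group_power sym_group_one)
  then show ?thesis
    using w unfolding r_def[symmetric]
    by (simp add: braid_class_power crossing_matrix_class braid_words_power
        word_crossing_matrix_pure_symmetric)
qed

section \<open>Spectra of real symmetric matrices\<close>

text \<open>For an eigenvector $v$ with $Av = ev$, moving $A$ across the inner product gives
  $e \langle v, v\rangle = \langle Av, v\rangle = \langle v, Av\rangle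
  = \bar e \langle v, v\rangle$, and $\langle v, v\rangle \neq 0$.\<close>

lemma hermitian_eigenvalue_real:
  fixes A :: "complex mat"
  assumes A: "A \<in> carrier_mat n n" and herm: "transpose_mat A = map_mat cnj A"
    and ev: "eigenvalue A e"
  shows "e \<in> \<real>"
proof -
  obtain v where v: "v \<in> carrier_vec n" "v \<noteq> 0\<^sub>v n" "A *\<^sub>v v = e \<cdot>\<^sub>v v"
    using ev A unfolding eigenvalue_def eigenvector_def by auto
  have conj: "map_mat cnj A *\<^sub>v conjugate v = conjugate (A *\<^sub>v v)"
    using A v(1) by (intro eq_vecI) (auto simp: scalar_prod_def)
  have "e * (v \<bullet>c v) = (transpose_mat (transpose_mat A) *\<^sub>v v) \<bullet>c v"
    using v by simp
  also have "\<dots> = v \<bullet> (transpose_mat A *\<^sub>v conjugate v)"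
    by (rule transpose_vec_mult_scalar[of _ n n]) (use A v in auto)
  also have "\<dots> = v \<bullet> (cnj e \<cdot>\<^sub>v conjugate v)"
    by (simp add: herm conj v(3) conjugate_smult_vec)
  also have "\<dots> = cnj e * (v \<bullet>c v)"
    using v(1) by simp
  finally have "e = cnj e"
    using v by simp
  then show ?thesis by (simp add: Reals_cnj_iff)
qed

text \<open>Over the complex numbers the characteristic polynomial splits; all its roots are eigenvalues of
  a Hermitian matrix, hence real. So the factorization is the image of a real one, and the inclusion
  of polynomial rings is injective.\<close>

lemma real_symmetric_char_poly_splits:
  fixes A :: "real mat"
  assumes A: "A \<in> carrier_mat n n" and sym: "transpose_mat A = A"
  obtains as where "char_poly A = (\<Prod>a\<leftarrow>as. [:- a, 1:])" "length as = n"
proof -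
  let ?C = "map_mat complex_of_real A"
  have C: "?C \<in> carrier_mat n n" using A by simp
  obtain zs where zs: "char_poly ?C = (\<Prod>z\<leftarrow>zs. [:- z, 1:])" "length zs = n"
    using char_poly_factorized[OF C] by blast
  have herm: "transpose_mat ?C = map_mat cnj ?C"
  proof -
    have "transpose_mat ?C = map_mat complex_of_real (transpose_mat A)"
      by auto
    also have "\<dots> = map_mat cnj ?C"
      unfolding sym by auto
    finally show ?thesis .
  qed
  have real: "z \<in> \<real>" if "z \<in> set zs" for z
  proof (rule hermitian_eigenvalue_real[OF C herm])
    show "eigenvalue ?C z"
      unfolding eigenvalue_root_char_poly[OF C] zs(1) by (rule linear_poly_root[OF that])
  qed
  interpret R: map_poly_inj_comm_ring_hom complex_of_real ..
  have "map_poly complex_of_real (char_poly A) = char_poly ?C"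
    by (rule of_real_hom.char_poly_hom[OF A, symmetric])
  also have "\<dots> = (\<Prod>z\<leftarrow>zs. map_poly complex_of_real [:- Re z, 1:])"
    unfolding zs(1) using real by (intro arg_cong[of _ _ prod_list] map_cong) auto
  also have "\<dots> = map_poly complex_of_real (\<Prod>a\<leftarrow>map Re zs. [:- a, 1:])"
    by (simp add: R.hom_prod_list o_def)
  finally have "char_poly A = (\<Prod>a\<leftarrow>map Re zs. [:- a, 1:])"
    by simp
  then show thesis using zs(2) by (intro that[of "map Re zs"]) auto
qed

lemma sum_diagonal_mult_commute:
  fixes A B :: "'a :: comm_semiring_0 mat"
  assumes "A \<in> carrier_mat n k" "B \<in> carrier_mat k n"
  shows "(\<Sum>i<n. (A * B) $$ (i, i)) = (\<Sum>j<k. (B * A) $$ (j, j))"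
proof -
  have "(\<Sum>i<n. (A * B) $$ (i, i)) = (\<Sum>i<n. \<Sum>j<k. A $$ (i, j) * B $$ (j, i))"
    using assms by (simp add: scalar_prod_def atLeast0LessThan)
  also have "\<dots> = (\<Sum>j<k. \<Sum>i<n. B $$ (j, i) * A $$ (i, j))"
    by (subst sum.swap) (simp add: mult.commute)
  also have "\<dots> = (\<Sum>j<k. (B * A) $$ (j, j))"
    using assms by (simp add: scalar_prod_def atLeast0LessThan)
  finally show ?thesis .
qed

text \<open>The Schur decomposition $A = PBQ$ with $Q = P^{-1}$ yields a triangular $B$ whose diagonal is
  the given list of roots, and the trace is invariant under conjugation.\<close>

lemma sum_list_eigenvalues_eq_sum_diagonal:
  fixes A :: "'a :: conjugatable_ordered_field mat"
  assumes A: "A \<in> carrier_mat n n" and split: "char_poly A = (\<Prod>a\<leftarrow>as. [:- a, 1:])"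
  shows "sum_list as = (\<Sum>i<n. A $$ (i, i))"
proof -
  obtain B P Q where dec: "schur_decomposition A as = (B, P, Q)"
    by (cases "schur_decomposition A as")
  have wit: "similar_mat_wit A B P Q" and diag: "diag_mat B = as"
    using schur_decomposition[OF A split dec] by auto
  note w = similar_mat_witD2[OF A wit]
  have "(\<Sum>i<n. A $$ (i, i)) = (\<Sum>i<n. (P * (B * Q)) $$ (i, i))"
    using w by (simp add: assoc_mult_mat[of _ n n _ n _ n])
  also have "\<dots> = (\<Sum>i<n. (B * Q * P) $$ (i, i))"
    by (rule sum_diagonal_mult_commute) (use w in auto)
  also have "B * Q * P = B"
    using w by (simp add: assoc_mult_mat[of _ n n _ n _ n])
  also have "(\<Sum>i<n. B $$ (i, i)) = sum_list as"
    using w by (simp add: diag[symmetric] diag_mat_def interv_sum_list_conv_sum_set_nat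
        atLeast0LessThan)
  finally show ?thesis ..
qed

section \<open>Roots of the characteristic polynomial of a braid\<close>

lemma braid_char_poly_splits:
  assumes "b \<in> carrier (braid_group m)"
  obtains as where "map_poly real_of_int (braid_char_poly m b) = (\<Prod>a\<leftarrow>as. [:- a, 1:])"
    "length as = m" "sum_list as = 0"
proof -
  define C where "C = crossing_matrix m (b [^]\<^bsub>braid_group m\<^esub> braid_perm_order m b)"
  let ?R = "map_mat real_of_int C"
  have C: "C \<in> carrier_mat m m" "transpose_mat C = C"
    using crossing_matrix_carrier crossing_matrix_power_order_symmetric[OF assms]
    by (simp_all add: C_def)
  have R: "?R \<in> carrier_mat m m" using C by simp
  have "transpose_mat ?R = map_mat real_of_int (transpose_mat C)" by auto
  then have sym: "transpose_mat ?R = ?R" using C by simp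
  obtain as where as: "char_poly ?R = (\<Prod>a\<leftarrow>as. [:- a, 1:])" "length as = m"
    using real_symmetric_char_poly_splits[OF R sym] .
  have "sum_list as = (\<Sum>i<m. ?R $$ (i, i))"
    by (rule sum_list_eigenvalues_eq_sum_diagonal[OF R as(1)])
  also have "\<dots> = 0"
    using C by (intro sum.neutral) (simp add: C_def crossing_matrix_diagonal)
  finally show thesis
    using as of_int_hom.char_poly_hom[OF C(1), where 'a = real]
    by (intro that[of as]) (simp_all add: braid_char_poly_def C_def)
qed

lemma braid_tuple_char_poly_splits:
  assumes "set bs \<subseteq> carrier (braid_group m)"
  obtains as where "map_poly real_of_int (braid_tuple_char_poly m bs) = (\<Prod>a\<leftarrow>as. [:- a, 1:])"
    "length as = m * length bs" "sum_list as = 0"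
  using assms
proof (induction bs arbitrary: thesis)
  case Nil
  show ?case by (rule Nil(1)[of "[]"]) (auto simp: braid_tuple_char_poly_def)
next
  case (Cons b bs)
  obtain as where as:
    "map_poly real_of_int (braid_tuple_char_poly m bs) = (\<Prod>a\<leftarrow>as. [:- a, 1:])"
    "length as = m * length bs" "sum_list as = 0"
    using Cons.IH Cons.prems(2) by auto
  obtain cs where cs: "map_poly real_of_int (braid_char_poly m b) = (\<Prod>a\<leftarrow>cs. [:- a, 1:])"
    "length cs = m" "sum_list cs = 0"
    using braid_char_poly_splits Cons.prems(2) by auto
  show ?case
    using as cs
    by (intro Cons.prems(1)[of "cs @ as"])
      (simp_all add: braid_tuple_char_poly_def of_int_poly_hom.hom_mult)
qed

theorem corollary2:
  fixes m n :: nat and bs :: "braid_letter list set list"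
  assumes "m \<ge> 2" and "n \<ge> 1"
    and "length bs = n" and "set bs \<subseteq> carrier (braid_group m)"
  shows "\<exists>a :: nat \<Rightarrow> real.
    map_poly real_of_int (braid_tuple_char_poly m bs) = (\<Prod>k=1..m*n. [:- a k, 1:]) \<and>
    (\<Sum>k=1..m*n. a k) = 0"
proof -
  obtain as where as:
    "map_poly real_of_int (braid_tuple_char_poly m bs) = (\<Prod>a\<leftarrow>as. [:- a, 1:])"
    "length as = m * n" "sum_list as = 0"
    using braid_tuple_char_poly_splits[OF assms(4)] assms(3) by auto
  \<comment> \<open>Lists are indexed from 0, whereas the roots are numbered from 1.\<close>
  have idx: "{1..m*n} = Suc ` {..<length as}"
    by (simp add: as(2) image_Suc_lessThan)
  have "(\<Prod>k=1..m*n. [:- (as ! (k - 1)), 1:]) = (\<Prod>a\<leftarrow>as. [:- a, 1:])"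
    unfolding idx by (simp add: prod.reindex prod.list_conv_set_nth atLeast0LessThan)
  moreover have "(\<Sum>k=1..m*n. as ! (k - 1)) = sum_list as"
    unfolding idx by (simp add: sum.reindex sum_list_sum_nth atLeast0LessThan)
  ultimately show ?thesis
    using as by (intro exI[of _ "\<lambda>k. as ! (k - 1)"]) simp
qed

end
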